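(* For all integers $1\le k\le n$, the following identity of polynomials in $q$ holds: $$\Delta_{n,k}(q)=\sum_{m=0}^{n-k}\binom{k+m}{1+m}\frac{\Gamma_{1+m}(q,n)\,\Delta_{n,k+m}(q)}{n^{1+m}}.$$
   Context: $s_2(k,i)$ denotes the Stirling number of the second kind (the number of partitions of a $k$-element set into $i$ nonempty blocks). For a positive integer $k$, $\Gamma_k(q,n)=\sum_{i=1}^{k}(-1)^{k-i}s_2(k,i)\,i!\,q^{i-1}n^{k-i}$. For natural numbers $1\le k<n$, $\Delta_{n,k}(q)=\sum_{1\le i_1<\dots<i_{n-k}\le n-1}(q-i_1)(q-i_2)\cdots(q-i_{n-k})$, and $\Delta_{n,n}(q)=1$. *)

theory Defs
  imports "HOL-Computational_Algebra.Polynomial" "HOL-Combinatorics.Stirling"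
begin

text \<open>The polynomial variable $q$ is \<open>[:0, 1:] = monom 1 1\<close>. The library constant \<^const>\<open>Stirling\<close> is
  the Stirling number of the second kind.\<close>

definition Gamma_poly :: "nat \<Rightarrow> nat \<Rightarrow> 'a::comm_ring_1 poly" where
  "Gamma_poly k n =
     (\<Sum>i=1..k. monom ((-1) ^ (k - i) * of_nat (Stirling k i * fact i * n ^ (k - i))) (i - 1))"

text \<open>A strictly increasing tuple $i_1 < \dots < i_{n-k}$ in $\{1,\dots,n-1\}$ is encoded as the
  subset \<open>I\<close> of its entries. The definition is intended for \<open>1 \<le> k \<le> n\<close>.\<close>

definition Delta_poly :: "nat \<Rightarrow> nat \<Rightarrow> 'a::comm_ring_1 poly" where
  "Delta_poly n k =
     (if k = n then 1
      else (\<Sum>I | I \<subseteq> {1..n - 1} \<and> card I = n - k. \<Prod>i\<in>I. [:0, 1:] - of_nat i))"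

end

theory Submission
  imports Defs
begin

text \<open>
  Let $P(x) = \prod_{i=1}^{n-1}(x + q - i)$, whose coefficient of $x^{k-1}$ is $\Delta_{n,k}(q)$, let
  $Q(x) = x P(x)$, and let $B$ be the backward difference operator $(B f)(x) = f(x) - f(x-1)$.
  Since $(x + q - n) P(x) = (x + q - 1) P(x-1)$, we have $B Q = n P - q B P$. As $B$ lowers degrees,
  iterating gives $P = \sum_{i=1}^{n} q^{i-1} n^{-i} B^i Q$. Expanding $B^i$ in derivatives,
  $B^i = \sum_r (-1)^{r-i}\, i!\, s_2(r,i)\, D^r/r!$, turns the operator on the right into
  $\sum_r \Gamma_r(q,n)\, n^{-r} D^r/r!$, and comparing coefficients of $x^{k-1}$ yields the theorem.
\<close>

section \<open>Alternating binomial sums and translates of polynomials\<close>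

lemma alternating_sum_binomial_power:
  "(\<Sum>l\<le>i. (-1) ^ l * of_nat (i choose l) * of_nat l ^ r) =
     ((-1) ^ i * of_nat (fact i * Stirling r i) :: 'a::comm_ring_1)"
proof (induction r arbitrary: i)
  case 0
  show ?case
  proof (cases i)
    case (Suc j)
    then show ?thesis using choose_alternating_sum[of i, where 'a = 'a] by simp
  qed simp
next
  case (Suc r)
  show ?case
  proof (cases i)
    case (Suc j)
    define a :: "nat \<Rightarrow> nat \<Rightarrow> 'a" where "a = (\<lambda>i l. (-1) ^ l * of_nat (i choose l) * of_nat l ^ r)"
    \<comment> \<open>Absorption \<open>l * (i choose l) = i * (j choose (l - 1))\<close> followed
      by Pascal's rule. Summed over \<open>l\<close>, it mirrors the recurrence
      \<open>Stirling (Suc r) i = i * Stirling r i + Stirling r j\<close>.\<close>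
    have summand: "(-1) ^ l * of_nat (i choose l) * of_nat l ^ Suc r = of_nat i * (a i l - a j l)"
      if "l \<le> i" for l
    proof (cases l)
      case (Suc m)
      have "of_nat l * (of_nat (i choose l) :: 'a) = of_nat i * of_nat (j choose m)"
        unfolding \<open>l = Suc m\<close> \<open>i = Suc j\<close> of_nat_mult[symmetric] by (simp only: Suc_times_binomial)
      moreover have "of_nat (i choose l) = (of_nat (j choose m) + of_nat (j choose l) :: 'a)"
        unfolding \<open>l = Suc m\<close> \<open>i = Suc j\<close> by simp
      ultimately have "of_nat l * (of_nat (i choose l) :: 'a)
          = of_nat i * (of_nat (i choose l) - of_nat (j choose l))"
        by simp
      then have "(-1) ^ l * of_nat l ^ r * (of_nat l * (of_nat (i choose l) :: 'a))
          = (-1) ^ l * of_nat l ^ r * (of_nat i * (of_nat (i choose l) - of_nat (j choose l)))"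
        by (rule arg_cong)
      then show ?thesis by (simp add: a_def algebra_simps)
    qed (simp add: a_def)
    have "(\<Sum>l\<le>i. (-1) ^ l * of_nat (i choose l) * of_nat l ^ Suc r)
        = of_nat i * ((\<Sum>l\<le>i. a i l) - (\<Sum>l\<le>i. a j l))"
      unfolding sum_subtractf[symmetric] sum_distrib_left by (intro sum.cong refl summand) simp
    also have "(\<Sum>l\<le>i. a j l) = (\<Sum>l\<le>j. a j l)"
      by (simp add: Suc a_def binomial_eq_0)
    finally show ?thesis
      unfolding a_def Suc.IH by (simp add: Suc algebra_simps)
  qed simp
qed

text \<open>Binomial theorem applied to each monomial. A free bound \<open>N\<close> lets later sums
  share one index range. For \<open>j < k\<close> the binomial coefficient vanishes, so the
  truncated \<open>j - k\<close> does no harm.\<close>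

lemma coeff_pcompose_linear:
  fixes p :: "'a::comm_ring_1 poly"
  assumes "degree p \<le> N"
  shows "coeff (p \<circ>\<^sub>p [:a, 1:]) k = (\<Sum>j\<le>N. coeff p j * of_nat (j choose k) * a ^ (j - k))"
proof -
  have "p \<circ>\<^sub>p [:a, 1:] = (\<Sum>j\<le>N. monom (coeff p j) j) \<circ>\<^sub>p [:a, 1:]"
    using assms by (simp only: poly_as_sum_of_monoms')
  also have "\<dots> = (\<Sum>j\<le>N. smult (coeff p j) ([:a, 1:] ^ j))"
    unfolding pcompose_sum by (simp add: pcompose_altdef map_poly_monom poly_monom)
  also have "coeff \<dots> k = (\<Sum>j\<le>N. coeff p j * coeff ([:a, 1:] ^ j) k)"
    by (simp add: coeff_sum)
  also have "\<dots> = (\<Sum>j\<le>N. coeff p j * of_nat (j choose k) * a ^ (j - k))"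
  proof (intro sum.cong refl)
    fix j
    show "coeff p j * coeff ([:a, 1:] ^ j) k = coeff p j * of_nat (j choose k) * a ^ (j - k)"
    proof (cases "k \<le> j")
      case True
      then show ?thesis by (simp add: coeff_linear_poly_power mult.assoc)
    next
      case False
      have "degree ([:a, 1:] ^ j) \<le> degree [:a, 1:] * j"
        by (rule degree_power_le)
      with False show ?thesis by (simp add: coeff_eq_0 binomial_eq_0)
    qed
  qed
  finally show ?thesis .
qed

section \<open>Powers of the backward difference operator\<close>

definition backward_diff :: "'a::comm_ring_1 poly \<Rightarrow> 'a poly" where
  "backward_diff p = p - p \<circ>\<^sub>p [:-1, 1:]"

lemma funpow_backward_diff_diff:
  "(backward_diff ^^ i) (p - q) = (backward_diff ^^ i) p - (backward_diff ^^ i) q"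
  by (induction i) (simp_all add: backward_diff_def pcompose_diff)

lemma funpow_backward_diff_smult:
  "(backward_diff ^^ i) (smult c p) = smult c ((backward_diff ^^ i) p)"
  by (induction i) (simp_all add: backward_diff_def pcompose_smult smult_diff_right)

text \<open>With \<open>E\<close> the translation by -1, this is the binomial expansion of
  \<open>(1 - E)^i\<close>; the induction step is Pascal's rule.\<close>

lemma funpow_backward_diff_eq_sum:
  "(backward_diff ^^ i) p = (\<Sum>l\<le>i. smult ((-1) ^ l * of_nat (i choose l)) (p \<circ>\<^sub>p [:- of_nat l, 1:]))"
proof (induction i)
  case (Suc i)
  define f where "f = (\<lambda>l. p \<circ>\<^sub>p [:- of_nat l, 1:])"
  have shift: "p \<circ>\<^sub>p [:- of_nat l, 1:] \<circ>\<^sub>p [:-1, 1:] = f (Suc l)" for l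
    by (simp add: f_def pcompose_pCons algebra_simps flip: pcompose_assoc)
  have "(backward_diff ^^ Suc i) p =
      (\<Sum>l\<le>Suc i. smult ((-1) ^ l * of_nat (i choose l)) (f l))
      - (\<Sum>l\<le>i. smult ((-1) ^ l * of_nat (i choose l)) (f (Suc l)))"
    by (simp add: Suc.IH backward_diff_def pcompose_sum pcompose_smult shift) (simp add: f_def binomial_eq_0)
  also have "\<dots> = (\<Sum>l\<le>Suc i. smult ((-1) ^ l * of_nat (Suc i choose l)) (f l))"
    by (simp add: sum.atMost_Suc_shift smult_add_left smult_diff_left algebra_simps sum.distrib sum_subtractf sum_negf
             del: sum.atMost_Suc)
  finally show ?case by (simp only: f_def)
qed simp

text \<open>Coefficient form of the expansion of \<open>B^i\<close> in the operators
  \<open>D^r/r!\<close>, with \<open>r = j - k\<close>: exchanging the sums leaves the alternating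
  sum above. The sign exponent is \<open>r + i\<close>, of the same parity as \<open>r - i\<close>
  but free of truncation.\<close>

lemma coeff_funpow_backward_diff:
  fixes p :: "'a::comm_ring_1 poly"
  assumes "degree p \<le> N"
  shows "coeff ((backward_diff ^^ i) p) k =
    (\<Sum>j\<le>N. coeff p j * of_nat (j choose k) *
       ((-1) ^ (j - k + i) * of_nat (fact i * Stirling (j - k) i)))"
proof -
  have "coeff ((backward_diff ^^ i) p) k =
      (\<Sum>l\<le>i. (-1) ^ l * of_nat (i choose l) *
         (\<Sum>j\<le>N. coeff p j * of_nat (j choose k) * (- of_nat l) ^ (j - k)))"
    by (simp add: funpow_backward_diff_eq_sum coeff_sum coeff_pcompose_linear[OF assms])
  also have "\<dots> = (\<Sum>j\<le>N. \<Sum>l\<le>i. coeff p j * of_nat (j choose k) *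
      ((-1) ^ (j - k) * ((-1) ^ l * of_nat (i choose l) * of_nat l ^ (j - k))))"
    unfolding sum_distrib_left
    by (subst sum.swap, intro sum.cong refl, subst power_minus) (simp add: mult_ac)
  also have "\<dots> = (\<Sum>j\<le>N. coeff p j * of_nat (j choose k) *
      ((-1) ^ (j - k) * (\<Sum>l\<le>i. (-1) ^ l * of_nat (i choose l) * of_nat l ^ (j - k))))"
    by (simp only: sum_distrib_left)
  finally show ?thesis
    unfolding alternating_sum_binomial_power by (simp add: power_add mult_ac)
qed

text \<open>Every \<open>Stirling (j - k) i\<close> in the coefficient formula is zero, because
  \<open>j - k\<close> is at most \<open>degree p < i\<close>.\<close>

lemma funpow_backward_diff_eq_0:
  assumes "degree p < i"
  shows "(backward_diff ^^ i) p = 0"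
proof (rule poly_eqI)
  fix k
  show "coeff ((backward_diff ^^ i) p) k = coeff 0 k"
    unfolding coeff_funpow_backward_diff[OF order_refl] coeff_0
    using assms by (intro sum.neutral ballI) simp
qed

section \<open>The generating function \<open>P\<close> and its difference equation\<close>

definition Delta_gf :: "nat \<Rightarrow> 'a::comm_ring_1 poly poly" where
  "Delta_gf n = (\<Prod>i=1..n - 1. [:[:0, 1:] - of_nat i, 1:])"

lemma degree_Delta_gf_le: "degree (Delta_gf n) \<le> n - 1"
proof -
  have "degree (Delta_gf n :: 'a poly poly)
      \<le> (\<Sum>i=1..n - 1. degree [:[:0, 1:] - of_nat i, 1 :: 'a poly:])"
    unfolding Delta_gf_def by (rule order_trans[OF degree_prod_sum_le]) auto
  then show ?thesis by simp
qed

text \<open>The outer variable of \<open>Delta_gf\<close> is x, and its coefficients are polynomials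
  in q. In the expanded product, \<open>X\<close> collects the factors contributing
  \<open>q - i\<close>; the other \<open>n - 1 - card X\<close> contribute x, so the power is
  \<open>k - 1\<close> exactly when \<open>card X = n - k\<close>.\<close>

lemma coeff_Delta_gf:
  assumes "1 \<le> k" "k \<le> n"
  shows "coeff (Delta_gf n) (k - 1) = Delta_poly n k"
proof -
  let ?A = "{1..n - 1}"
  let ?g = "\<lambda>X. \<Prod>i\<in>X. [:0, 1:] - of_nat i :: 'a poly"
  have "Delta_gf n = (\<Prod>i\<in>?A. [:[:0, 1:] - of_nat i:] + monom 1 1)"
    by (simp add: Delta_gf_def monom_altdef)
  also have "\<dots> = (\<Sum>X\<in>Pow ?A. [:?g X:] * monom 1 (card (?A - X)))"
    by (subst prod_add) (simp_all add: monom_power prod_to_poly)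
  finally have "coeff (Delta_gf n) (k - 1)
      = (\<Sum>X\<in>Pow ?A. if card (?A - X) = k - 1 then ?g X else 0)"
    by (simp add: coeff_sum if_distrib cong: if_cong)
  also have "\<dots> = (\<Sum>X | X \<subseteq> ?A \<and> card X = n - k. ?g X)"
  proof (rule sum.mono_neutral_cong_right)
    have "card (?A - X) = k - 1 \<longleftrightarrow> card X = n - k" if "X \<subseteq> ?A" for X
    proof -
      have "card (?A - X) = n - 1 - card X" "card X \<le> n - 1"
        using that card_mono[OF _ that] by (simp_all add: card_Diff_subset finite_subset)
      with assms show ?thesis by auto
    qed
    then show "\<forall>X\<in>Pow ?A - {X. X \<subseteq> ?A \<and> card X = n - k}.
        (if card (?A - X) = k - 1 then ?g X else 0) = 0"
      and "\<And>X. X \<in> {X. X \<subseteq> ?A \<and> card X = n - k} \<Longrightarrow>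
        (if card (?A - X) = k - 1 then ?g X else 0) = ?g X"
      by auto
  qed auto
  also have "\<dots> = Delta_poly n k"
  proof (cases "k = n")
    case True
    have "{X. X \<subseteq> ?A \<and> card X = 0} = {{}}"
      by (auto dest: finite_subset)
    with True show ?thesis by (simp add: Delta_poly_def)
  qed (simp add: Delta_poly_def)
  finally show ?thesis .
qed

text \<open>Replacing x by x - 1 turns the factor of index \<open>i\<close> into that of index
  \<open>Suc i\<close>, so (x + q - 1) P(x - 1) and (x + q - n) P(x) are both the product over 1..n.
  Here \<open>pCons 0\<close> multiplies by x and \<open>smult [:0, 1:]\<close> by q.\<close>

lemma backward_diff_x_Delta_gf:
  assumes "1 \<le> n"
  shows "backward_diff (pCons 0 (Delta_gf n)) =
    smult (of_nat n) (Delta_gf n) - smult [:0, 1:] (backward_diff (Delta_gf n))"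
proof -
  let ?f = "\<lambda>i. [:[:0, 1:] - of_nat i, 1 :: 'a poly:]"
  have "Delta_gf n \<circ>\<^sub>p [:-1, 1:] = (\<Prod>i=1..n - 1. ?f (Suc i))"
    by (simp add: Delta_gf_def pcompose_prod pcompose_pCons algebra_simps)
  also have "\<dots> = (\<Prod>i=Suc 1..Suc (n - 1). ?f i)"
    by (simp only: prod.shift_bounds_cl_Suc_ivl)
  finally have "?f 1 * (Delta_gf n \<circ>\<^sub>p [:-1, 1:]) = (\<Prod>i=1..Suc (n - 1). ?f i)"
    by (subst prod.atLeast_Suc_atMost) simp_all
  also have "\<dots> = ?f n * Delta_gf n"
    using assms by (cases n) (simp_all add: Delta_gf_def mult.commute)
  finally have "?f n * Delta_gf n = ?f 1 * (Delta_gf n \<circ>\<^sub>p [:-1, 1:])" ..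
  then show ?thesis
    by (simp add: backward_diff_def pcompose_pCons smult_diff_left smult_diff_right algebra_simps)
qed

lemma Delta_gf_eq_sum_backward_diff:
  fixes n :: nat
  assumes "1 \<le> n"
  defines "c \<equiv> [:inverse (of_nat n) :: 'a::field_char_0:]"
  shows "Delta_gf n =
    (\<Sum>i<n. smult ([:0, 1:] ^ i * c ^ Suc i) ((backward_diff ^^ Suc i) (pCons 0 (Delta_gf n))))"
proof -
  let ?P = "Delta_gf n :: 'a poly poly"
  \<comment> \<open>Applying \<open>B^i\<close> to the difference equation and scaling by
    \<open>q^i / n^(i+1)\<close> makes the sum telescope in
    \<open>g i = (q/n)^i B^i P\<close>.\<close>
  define g where "g = (\<lambda>i. smult ([:0, 1:] ^ i * c ^ i) ((backward_diff ^^ i) ?P))"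
  have c: "c * of_nat n = 1"
    using assms by (simp add: c_def of_nat_poly one_pCons)
  have "smult ([:0, 1:] ^ i * c ^ Suc i) ((backward_diff ^^ Suc i) (pCons 0 ?P)) = g i - g (Suc i)" for i
  proof -
    have "(backward_diff ^^ Suc i) (pCons 0 ?P)
        = smult (of_nat n) ((backward_diff ^^ i) ?P) - smult [:0, 1:] ((backward_diff ^^ Suc i) ?P)"
      unfolding funpow_Suc_right o_apply backward_diff_x_Delta_gf[OF assms(1)]
        funpow_backward_diff_diff funpow_backward_diff_smult ..
    moreover have "[:0, 1:] ^ i * c ^ Suc i * of_nat n = [:0, 1:] ^ i * c ^ i * (c * of_nat n)"
      by (simp only: power_Suc mult_ac)
    moreover have "[:0, 1:] ^ i * c ^ Suc i * [:0, 1:] = [:0, 1:] ^ Suc i * c ^ Suc i"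
      by (simp only: power_Suc mult_ac)
    ultimately show ?thesis
      by (simp only: g_def smult_diff_right smult_smult c mult_1_right)
  qed
  then have "(\<Sum>i<n. smult ([:0, 1:] ^ i * c ^ Suc i) ((backward_diff ^^ Suc i) (pCons 0 ?P)))
      = g 0 - g n"
    by (simp only: sum_lessThan_telescope')
  moreover have "g n = 0"
    using degree_Delta_gf_le[of n, where 'a = 'a] assms by (simp add: g_def funpow_backward_diff_eq_0)
  ultimately show ?thesis by (simp add: g_def)
qed

text \<open>The right side is what the expansion of \<open>P\<close> produces in front of
  \<open>D^r/r!\<close>. It follows from \<open>n^(r-i) / n^r = 1 / n^i\<close> and the index shift
  from \<open>i\<close> to \<open>Suc i\<close>.\<close>

lemma smult_Gamma_poly:
  fixes n r :: nat
  assumes "1 \<le> n" "r \<le> n"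
  shows "smult (1 / of_nat n ^ r) (Gamma_poly r n :: 'a::field_char_0 poly) =
    (\<Sum>i<n. [:0, 1:] ^ i * [:inverse (of_nat n):] ^ Suc i *
       ((-1) ^ (r + Suc i) * of_nat (fact (Suc i) * Stirling r (Suc i))))"
proof -
  let ?t = "\<lambda>i. monom ((-1) ^ (r + Suc i) * of_nat (fact (Suc i) * Stirling r (Suc i))
    / of_nat n ^ Suc i) i :: 'a poly"
  have eq: "smult (1 / of_nat n ^ r) (monom ((-1) ^ (r - Suc i) *
      of_nat (Stirling r (Suc i) * fact (Suc i) * n ^ (r - Suc i))) i) = ?t i" if "i < r" for i
  proof -
    have "(of_nat n :: 'a) ^ r = of_nat n ^ (r - Suc i) * of_nat n ^ Suc i"
      using that by (subst power_add[symmetric]) simp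
    moreover have "((-1) ^ (r + Suc i) :: 'a) = (-1) ^ (r - Suc i)"
      using that by (simp add: uminus_power_if)
    ultimately show ?thesis using assms(1) by (simp add: smult_monom field_simps)
  qed
  have closed: "?t i = [:0, 1:] ^ i * [:inverse (of_nat n):] ^ Suc i *
       ((-1) ^ (r + Suc i) * of_nat (fact (Suc i) * Stirling r (Suc i)))" for i
  proof -
    have "((-1) ^ (r + Suc i) * of_nat (fact (Suc i) * Stirling r (Suc i)) :: 'a poly)
        = [:(-1) ^ (r + Suc i) * of_nat (fact (Suc i) * Stirling r (Suc i)):]"
    proof -
      have "(-1) ^ (r + Suc i) = [:(-1) ^ (r + Suc i) :: 'a:]"
        by (simp only: poly_const_pow[symmetric] one_pCons minus_pCons minus_zero)
      then show ?thesis by (simp only: of_nat_poly) simp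
    qed
    then show ?thesis
      by (simp add: monom_altdef poly_const_pow divide_inverse power_inverse mult_ac
            del: fact_Suc power_Suc)
  qed
  have smult_sum_right: "smult c (sum f A) = (\<Sum>i\<in>A. smult c (f i))"
    for c :: 'a and f :: "nat \<Rightarrow> 'a poly" and A
    by (rule poly_eqI) (simp add: coeff_sum sum_distrib_left)
  have "smult (1 / of_nat n ^ r) (Gamma_poly r n) = (\<Sum>i<r. ?t i)"
    unfolding Gamma_poly_def image_Suc_lessThan[symmetric]
    unfolding sum.reindex[OF inj_Suc[THEN inj_on_subset, OF subset_UNIV]] smult_sum_right o_apply diff_Suc_1
    by (intro sum.cong refl eq) simp
  \<comment> \<open>The added terms vanish, since \<open>Stirling r (Suc i) = 0\<close> for
    \<open>i >= r\<close>.\<close>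
  also have "\<dots> = (\<Sum>i<n. ?t i)"
    using assms(2) by (intro sum.mono_neutral_left) auto
  finally show ?thesis by (simp only: closed)
qed

section \<open>Comparison of the coefficients of \<open>x^(k-1)\<close>\<close>

theorem theorem3p4:
  fixes n k :: nat
  assumes "1 \<le> k" and "k \<le> n"
  shows "(Delta_poly n k :: 'a::field_char_0 poly) =
    (\<Sum>m=0..n - k. smult (of_nat ((k + m) choose (1 + m)) / of_nat n ^ (1 + m))
                     (Gamma_poly (1 + m) n * Delta_poly n (k + m)))"
proof -
  have n: "1 \<le> n" using assms by simp
  let ?Q = "pCons 0 (Delta_gf n) :: 'a poly poly"
  let ?q = "[:0, 1:] :: 'a poly" and ?c = "[:inverse (of_nat n) :: 'a:]"
  let ?S = "\<lambda>r i. (-1) ^ (r + Suc i) * of_nat (fact (Suc i) * Stirling r (Suc i)) :: 'a poly"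
  have deg: "degree ?Q \<le> n"
    using degree_Delta_gf_le[of n, where 'a = 'a] n
    by (intro order_trans[OF degree_pCons_le]) simp
  have "Delta_poly n k = coeff (Delta_gf n) (k - 1)"
    using assms by (simp only: coeff_Delta_gf)
  also have "\<dots> = (\<Sum>i<n. ?q ^ i * ?c ^ Suc i *
      (\<Sum>j\<le>n. coeff ?Q j * of_nat (j choose (k - 1)) * ?S (j - (k - 1)) i))"
    by (subst Delta_gf_eq_sum_backward_diff[OF n])
      (simp only: coeff_sum coeff_smult coeff_funpow_backward_diff[OF deg])
  also have "\<dots> = (\<Sum>j\<le>n. coeff ?Q j * of_nat (j choose (k - 1)) *
      (\<Sum>i<n. ?q ^ i * ?c ^ Suc i * ?S (j - (k - 1)) i))"
    unfolding sum_distrib_left by (subst sum.swap) (simp only: mult_ac)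
  also have "\<dots> = (\<Sum>j\<le>n. coeff ?Q j * of_nat (j choose (k - 1)) *
      smult (1 / of_nat n ^ (j - (k - 1))) (Gamma_poly (j - (k - 1)) n))"
    using n by (intro sum.cong refl, subst smult_Gamma_poly) auto
  \<comment> \<open>For \<open>j < k\<close> the index \<open>j - (k - 1)\<close> is 0, and
    \<open>Gamma_poly 0 n\<close> is an empty sum.\<close>
  also have "\<dots> = (\<Sum>j=k..n. coeff ?Q j * of_nat (j choose (k - 1)) *
      smult (1 / of_nat n ^ (j - (k - 1))) (Gamma_poly (j - (k - 1)) n))"
    by (rule sum.mono_neutral_right) (auto simp: Gamma_poly_def)
  also have "\<dots> = (\<Sum>m=0..n - k. coeff ?Q (k + m) * of_nat ((k + m) choose (k - 1)) *
      smult (1 / of_nat n ^ (1 + m)) (Gamma_poly (1 + m) n))"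
    by (rule sum.reindex_bij_witness[of _ "\<lambda>m. k + m" "\<lambda>j. j - k"])
      (use assms in \<open>auto simp: Suc_diff_le\<close>)
  also have "\<dots> = (\<Sum>m=0..n - k. smult (of_nat ((k + m) choose (1 + m)) / of_nat n ^ (1 + m))
                     (Gamma_poly (1 + m) n * Delta_poly n (k + m)))"
  proof (intro sum.cong refl)
    fix m
    assume m: "m \<in> {0..n - k}"
    have "(k + m) choose (k - 1) = (k + m) choose (1 + m)"
      using assms by (subst binomial_symmetric) auto
    \<comment> \<open>The factor x in Q = x P absorbs the index shift by one in
      \<open>coeff_Delta_gf\<close>.\<close>
    moreover have "coeff ?Q (k + m) = Delta_poly n (k + m)"
      using coeff_Delta_gf[of "k + m" n, where 'a = 'a] assms m
      by (cases "k + m") (simp_all del: of_nat_Suc)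
    ultimately show "coeff ?Q (k + m) * of_nat ((k + m) choose (k - 1)) *
        smult (1 / of_nat n ^ (1 + m)) (Gamma_poly (1 + m) n) =
      smult (of_nat ((k + m) choose (1 + m)) / of_nat n ^ (1 + m))
        (Gamma_poly (1 + m) n * Delta_poly n (k + m))"
      by (simp add: of_nat_poly mult_ac)
  qed
  finally show ?thesis .
qed

end
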